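(* Let $b>0$ and $\rho>0$ be real numbers and define, for $z=x+\mathrm{i}y\in\mathbb{C}\setminus[0,\infty)$, $$\Psi^M(z)=-\frac{\mathrm{i}b\rho}{2\pi}\,z\bigl(\ln(-z)-1\bigr),$$ where $\ln$ is the principal branch of the complex logarithm. Then the plastic displacement gradients of the wedge disclination monopole are obtained from $\Psi^M$: at every such $z$, $$\Theta^2_1(x,y)=\operatorname{Re}\Bigl(\frac{d\Psi^M}{dz}\Bigr),\qquad \Theta^2_2(x,y)=-\operatorname{Im}\Bigl(\frac{d\Psi^M}{dz}\Bigr),$$ where $(\Theta^2_1,\Theta^2_2)$ is the plastic displacement gradient of the monopole defined in the context.
   Context: The non-vanishing plastic displacement gradient components (along $dx$ and $dy$) of the wedge disclination monopole at the origin (equivalently, of the semi-infinite edge dislocation array with torsion $b\rho\,\delta(y)H(x)\,dx\wedge dy$, with $\delta$ the Dirac delta and $H$ the Heaviside function) are $$\Theta^2_1=\frac{b\rho}{2\pi}\arg\tfrac{y}{x},\qquad \Theta^2_2=\frac{b\rho}{2\pi}\ln\sqrt{x^2+y^2}.$$ Here $\arg(y/x)$ is notation for the function of the point $(x,y)$ that equals $0$ if $y=0$ and otherwise equals the angle in $(-\pi,\pi)$ of $(x,y)$ measured from the negative $x$-axis; explicitly, $\arctan(y/x)$ for $x<0$, $\arctan(y/x)-\pi$ for $x>0,y>0$, $\arctan(y/x)+\pi$ for $x>0,y<0$, and by continuity $-\pi/2$ (resp. $+\pi/2$) for $x=0$, $y>0$ (resp. $y<0$). *)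

theory Defs
  imports "HOL-Analysis.Analysis"
begin

(* The function written "arg (y/x)": the angle in (-pi, pi) of the point (x, y) measured
   from the negative x-axis.  It depends on the point (x, y), not just on the quotient y/x;
   its jump is across the positive x-axis, on which (as on all of y = 0) the value is 0 by
   convention. *)
definition arg_yx :: "real \<Rightarrow> real \<Rightarrow> real" where
  "arg_yx x y =
     (if y = 0 then 0
      else if x < 0 then arctan (y / x)
      else if x > 0 then (if y > 0 then arctan (y / x) - pi else arctan (y / x) + pi)
      else (if y > 0 then - (pi / 2) else pi / 2))"

(* Components Theta^2_1 (along dx) and Theta^2_2 (along dy) of the plastic displacement
   gradient of the wedge disclination monopole at the origin.  At the origin itself
   Theta2_2 is meaningless (there ln 0 = 0 by convention). *)
definition Theta2_1 :: "real \<Rightarrow> real \<Rightarrow> real \<Rightarrow> real \<Rightarrow> real" where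
  "Theta2_1 b \<rho> x y = b * \<rho> / (2 * pi) * arg_yx x y"

definition Theta2_2 :: "real \<Rightarrow> real \<Rightarrow> real \<Rightarrow> real \<Rightarrow> real" where
  "Theta2_2 b \<rho> x y = b * \<rho> / (2 * pi) * ln (sqrt (x\<^sup>2 + y\<^sup>2))"

(* The complex potential is only meant on the complement of [0, infinity), an open set;
   the values elsewhere are those of the total function Ln and do not affect derivatives
   at points of the domain. *)
definition Psi_M :: "real \<Rightarrow> real \<Rightarrow> complex \<Rightarrow> complex" where
  "Psi_M b \<rho> z = - (\<i> * of_real b * of_real \<rho> / (2 * of_real pi)) * z * (Ln (- z) - 1)"

end

theory Submission
  imports Defs
begin

text \<open>With \<open>c = b * \<rho> / (2 * pi)\<close>, the derivative of the potential is
  \<open>- \<i> * c * Ln (- z)\<close>, whose real part is \<open>c * Im (Ln (- z))\<close> and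
  whose imaginary part is \<open>- c * Re (Ln (- z))\<close>. Negation turns the angle from the
  negative x-axis into the principal argument of \<open>- z\<close>
  (\<open>arg_yx_eq_Im_Ln\<close>), and \<open>Re (Ln (- z))\<close> is the log of the
  modulus.\<close>

lemma arg_yx_eq_Im_Ln:
  assumes "z \<notin> complex_of_real ` {0..}"
  shows "arg_yx (Re z) (Im z) = Im (Ln (- z))"
proof -
  \<comment> \<open>On the real axis only \<open>Re z < 0\<close> remains, where the conventional
    value 0 is the true angle; on the positive axis \<open>Im (Ln (- z))\<close> would be
    \<open>pi\<close>.\<close>
  have "z \<noteq> 0" "Im z = 0 \<Longrightarrow> Re z < 0"
    using assms by (force simp: complex_eq_iff image_iff not_le[symmetric])+
  then show ?thesis
    by (auto simp: arg_yx_def Im_Ln_eq complex_eq_iff)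
qed

text \<open>The product rule yields the extra term \<open>z * (1 / z) = 1\<close>, which the
  \<open>- 1\<close> in the potential cancels.\<close>

lemma DERIV_Psi_M:
  assumes "z \<notin> complex_of_real ` {0..}"
  shows "(Psi_M b \<rho> has_field_derivative - (\<i> * of_real (b * \<rho> / (2 * pi)) * Ln (- z))) (at z)"
proof -
  \<comment> \<open>The excluded ray is exactly the branch cut of \<open>Ln (- z)\<close>.\<close>
  have "- z \<notin> \<real>\<^sub>\<le>\<^sub>0"
    using assms by (force simp: complex_nonpos_Reals_iff complex_eq_iff image_iff)
  moreover from this have "z \<noteq> 0"
    by auto
  ultimately show ?thesis
    unfolding Psi_M_def [abs_def]
    by (auto intro!: derivative_eq_intros simp: field_simps)
qed

theorem theorem5p2:
  fixes b \<rho> :: real and z :: complex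
  assumes "b > 0" and "\<rho> > 0"
    and "z \<notin> complex_of_real ` {0..}"
  shows "Psi_M b \<rho> field_differentiable (at z)
    \<and> Theta2_1 b \<rho> (Re z) (Im z) = Re (deriv (Psi_M b \<rho>) z)
    \<and> Theta2_2 b \<rho> (Re z) (Im z) = - Im (deriv (Psi_M b \<rho>) z)"
proof -
  note D = DERIV_Psi_M [OF assms(3), of b \<rho>]
  have "z \<noteq> 0"
    using assms(3) by force
  then have "Re (Ln (- z)) = ln (sqrt ((Re z)\<^sup>2 + (Im z)\<^sup>2))"
    by (simp add: cmod_def)
  then show ?thesis
    using D by (auto simp: field_differentiable_def DERIV_imp_deriv [OF D] Theta2_1_def
        Theta2_2_def arg_yx_eq_Im_Ln [OF assms(3)])
qed

end
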